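(* Let $G$ be a connected $d$-regular graph with $d\ge 3$. If \[ \lambda_2(G) < \begin{cases} \frac{d-2+\sqrt{d^2+12}}{2}, & \text{if } d \text{ is even},\\ \frac{d-2+\sqrt{d^2+8}}{2}, & \text{if } d \text{ is odd},\end{cases} \] then $\kappa(G)\ge 2$.
   Context: All graphs are finite, undirected and simple. For a graph $G$ of order $n$, $\lambda_1(G)\ge\lambda_2(G)\ge\dots\ge\lambda_n(G)$ denote the eigenvalues of its adjacency matrix (with multiplicity). $\kappa(G)$ denotes the vertex-connectivity of $G$, i.e. the minimum number of vertices whose removal produces a disconnected graph or a graph with fewer than $2$ vertices. *)

theory Defs
  imports
    Complex_Main
    "HOL-Library.Multiset"
    "Jordan_Normal_Form.Char_Poly"
    "Graph_Theory.Digraph_Component"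
begin

text \<open>
  Finite simple undirected graphs are the locale \<open>graph\<close> of \<open>Graph_Theory\<close>: finite symmetric
  digraphs without loops and parallel arcs. An edge is thus a pair of opposite arcs, so that the
  degree of a vertex is its out-degree.
\<close>

definition regular_graph :: "nat \<Rightarrow> ('a, 'b) pre_digraph \<Rightarrow> bool" where
  "regular_graph d G \<longleftrightarrow> graph G \<and> (\<forall>v \<in> verts G. out_degree G v = d)"

definition adj_matrix :: "('a, 'b) pre_digraph \<Rightarrow> 'a list \<Rightarrow> real mat" where
  "adj_matrix G vs = mat (length vs) (length vs)
     (\<lambda>(i, j). if (vs ! i, vs ! j) \<in> arcs_ends G then 1 else 0)"

text \<open>
  The order in which the vertices are listed is immaterial: another enumeration conjugates the
  adjacency matrix by a permutation matrix, which preserves the characteristic polynomial.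
\<close>

definition vertex_list :: "('a, 'b) pre_digraph \<Rightarrow> 'a list" where
  "vertex_list G = (SOME vs. distinct vs \<and> set vs = verts G)"

text \<open>
  Since the adjacency matrix is real symmetric, its characteristic polynomial splits over the
  reals, and the roots counted with multiplicity are all the eigenvalues.
\<close>

definition graph_spectrum :: "('a, 'b) pre_digraph \<Rightarrow> real multiset" where
  "graph_spectrum G = proots (char_poly (adj_matrix G (vertex_list G)))"

text \<open>The \<open>k\<close>-th largest eigenvalue; \<open>k\<close> counts from 1 up to the order of the graph.\<close>

definition graph_eigenvalue :: "nat \<Rightarrow> ('a, 'b) pre_digraph \<Rightarrow> real" where
  "graph_eigenvalue k G = rev (sorted_list_of_multiset (graph_spectrum G)) ! (k - 1)"

definition vertex_connectivity :: "('a, 'b) pre_digraph \<Rightarrow> nat" where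
  "vertex_connectivity G = (LEAST k. \<exists>S \<subseteq> verts G. card S = k \<and>
     (\<not> Digraph_Component.connected (G \<restriction> (verts G - S)) \<or> card (verts G - S) < 2))"

end

theory Submission
  imports Defs "Jordan_Normal_Form.Schur_Decomposition"
begin

text \<open>
  A connected regular graph of degree \<open>d \<ge> 3\<close> whose connectivity is less than 2 has a cut vertex
  \<open>v\<close>. The other vertices split into two nonempty sides without edges between them. A function on one
  side and a function on the other are orthogonal, also with respect to the adjacency form, and so
  \<open>\<lambda>\<^sub>2\<close> is at least the smaller of their two Rayleigh quotients. It remains to find on each side a
  function whose Rayleigh quotient reaches the bound of the theorem
  (\<open>second_eigenvalue_ge_of_separated_sets\<close>).

  A side is nearly \<open>d\<close>-regular: its degrees are \<open>d\<close>, or \<open>d - 1\<close> at the neighbours of \<open>v\<close>. Moreover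
  \<open>v\<close> has neighbours on the other side too, and for even \<open>d\<close> it has at least two there,
  by a parity argument (\<open>even_boundary_of_even_regular\<close>). So at most \<open>d - 1\<close> vertices of a side are
  neighbours of \<open>v\<close>, and at most \<open>d - 2\<close> if \<open>d\<close> is even, whereas a side has at least \<open>d + 1\<close> vertices
  (\<open>side_size\<close>). Constant functions are not good enough: the test function takes a slightly smaller
  value on the neighbours of \<open>v\<close> than elsewhere. The best ratio is read off from the extremal graph, in
  which the side has exactly \<open>d + 1\<close> vertices and the partition into neighbours and non-neighbours of \<open>v\<close>
  is equitable; its quotient matrix has the eigenvalue in the theorem. A direct computation shows
  that the same kind of function works on every side (\<open>side_test_vector\<close>, \<open>side_bound\<close>).

  The eigenvalues are roots of a characteristic polynomial with multiplicity. The real spectral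
  theorem (\<open>real_spectral_theorem\<close>) identifies them with the entries of an orthogonal
  diagonalization, and from this follows the part of the Courant--Fischer principle in use
  (\<open>second_root_ge\<close>).
\<close>

section \<open>The second eigenvalue of a real symmetric matrix\<close>

text \<open>
  Over the complex numbers an eigenvector \<open>z\<close> exists, with eigenvalue \<open>c\<close>. Moving the
  symmetric matrix from one factor of \<open>conjugate z \<bullet> z\<close> to the other shows that \<open>c\<close> equals its
  conjugate, so \<open>c\<close> is a real root of the real characteristic polynomial.
\<close>

lemma symmetric_mat_real_eigenvector:
  fixes A :: "real mat"
  assumes A: "A \<in> carrier_mat n n" and sym: "A\<^sup>T = A" and n: "0 < n"
  shows "\<exists>v e. v \<in> carrier_vec n \<and> v \<noteq> 0\<^sub>v n \<and> A *\<^sub>v v = e \<cdot>\<^sub>v v"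
proof -
  define C where "C = map_mat complex_of_real A"
  have C: "C \<in> carrier_mat n n" using A by (simp add: C_def)
  have Ct: "C\<^sup>T = C" unfolding C_def using sym A by (metis map_mat_transpose)
  obtain as where as: "char_poly C = (\<Prod>a\<leftarrow>as. [:- a, 1:])" "length as = n"
    using char_poly_factorized[OF C] by blast
  then obtain c where "c \<in> set as" using n by (cases as) auto
  then have "poly (char_poly C) c = 0"
    unfolding as(1) poly_prod_list by (auto simp: prod_list_zero_iff o_def)
  then have "eigenvalue C c" using eigenvalue_root_char_poly[OF C] by simp
  then obtain z where z: "z \<in> carrier_vec n" "z \<noteq> 0\<^sub>v n" "C *\<^sub>v z = c \<cdot>\<^sub>v z"
    using C unfolding eigenvalue_def eigenvector_def by auto
  have zc: "conjugate z \<in> carrier_vec n" using z by simp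
  have conj: "C *\<^sub>v conjugate z = cnj c \<cdot>\<^sub>v conjugate z"
  proof (rule eq_vecI)
    fix i assume "i < dim_vec (cnj c \<cdot>\<^sub>v conjugate z)"
    then have i: "i < n" using z by simp
    have "(C *\<^sub>v conjugate z) $ i = cnj ((C *\<^sub>v z) $ i)"
      using i z(1) A by (auto simp: C_def scalar_prod_def intro!: sum.cong)
    then show "(C *\<^sub>v conjugate z) $ i = (cnj c \<cdot>\<^sub>v conjugate z) $ i"
      using i z by simp
  qed (use C z in auto)
  have "c * (conjugate z \<bullet> z) = conjugate z \<bullet> (C *\<^sub>v z)" using z zc by simp
  also have "\<dots> = (C *\<^sub>v conjugate z) \<bullet> z"
    using transpose_vec_mult_scalar[OF C z(1) zc] Ct by simp
  also have "\<dots> = cnj c * (conjugate z \<bullet> z)" unfolding conj using z zc by simp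
  finally have "c = cnj c \<or> conjugate z \<bullet> z = 0" unfolding mult_cancel_right by blast
  moreover have "conjugate z \<bullet> z \<noteq> 0"
    using z conjugate_square_eq_0_vec[of z n] comm_scalar_prod[OF zc z(1)] by auto
  ultimately have "c = cnj c" by blast
  then have "c = complex_of_real (Re c)" by (simp add: complex_eq_iff)
  then have "poly (char_poly C) (complex_of_real (Re c)) = 0"
    using \<open>poly (char_poly C) c = 0\<close> by simp
  moreover have "char_poly C = map_poly complex_of_real (char_poly A)"
    unfolding C_def using of_real_hom.char_poly_hom[OF A] .
  ultimately have "poly (char_poly A) (Re c) = 0" by simp
  then have "eigenvalue A (Re c)" using eigenvalue_root_char_poly[OF A] by simp
  then show ?thesis using A unfolding eigenvalue_def eigenvector_def by auto
qed

text \<open>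
  Complete \<open>v\<close> to a basis, apply Gram--Schmidt, which keeps the first vector, and normalize.
\<close>

lemma orthogonal_mat_with_first_column:
  fixes v :: "real vec"
  assumes v: "v \<in> carrier_vec n" and v0: "v \<noteq> 0\<^sub>v n"
  shows "\<exists>W c. W \<in> carrier_mat n n \<and> W\<^sup>T * W = 1\<^sub>m n \<and> col W 0 = c \<cdot>\<^sub>v v"
proof -
  interpret cof_vec_space n "TYPE(real)" .
  define ws where "ws = gram_schmidt n (basis_completion v)"
  note b = basis_completion[OF v v0]
  have n: "0 < n" using v v0 by (cases n) auto
  have ws: "set ws \<subseteq> carrier_vec n" "corthogonal ws" "length ws = n"
    using gram_schmidt_result[OF b(2,4,5) ws_def] b(6) by auto
  have "basis_completion v = v # tl (basis_completion v)"
    using b(6,7) n by (cases "basis_completion v") auto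
  then have hd: "ws ! 0 = v"
    using gram_schmidt_hd[OF v] ws(3) n unfolding ws_def by (metis hd_conv_nth length_0_conv less_numeral_extra(3))
  have wsi: "ws ! i \<in> carrier_vec n" if "i < n" for i using ws that by auto
  have orth: "ws ! i \<bullet> ws ! j = 0 \<longleftrightarrow> i \<noteq> j" if "i < n" "j < n" for i j
    using corthogonalD[OF ws(2)] ws(3) that by (simp add: conjugate_vec_def)
  define u where "u i = (1 / sqrt (ws ! i \<bullet> ws ! i)) \<cdot>\<^sub>v (ws ! i)" for i
  have u: "u i \<in> carrier_vec n" if "i < n" for i using wsi that by (simp add: u_def)
  have uu: "u i \<bullet> u j = (if i = j then 1 else 0)" if "i < n" "j < n" for i j
  proof -
    have "ws ! i \<bullet> ws ! i \<ge> 0" by (simp add: scalar_prod_def sum_nonneg)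
    then show ?thesis using that wsi[of i] wsi[of j] orth[of i j] by (auto simp: u_def)
  qed
  define W where "W = mat_of_cols n (map u [0..<n])"
  have W: "W \<in> carrier_mat n n" by (auto simp: W_def)
  have col: "col W i = u i" if "i < n" for i using that u by (simp add: W_def)
  have "W\<^sup>T * W = 1\<^sub>m n"
    by (rule eq_matI) (use W col uu in auto)
  moreover have "col W 0 = (1 / sqrt (v \<bullet> v)) \<cdot>\<^sub>v v" using col[of 0] n hd by (simp add: u_def)
  ultimately show ?thesis using W by blast
qed

text \<open>
  Induction on the dimension. In an orthonormal basis that starts with an eigenvector, the first
  column of the matrix is a multiple of the first unit vector. By symmetry so is the first row, and
  the induction hypothesis diagonalizes the remaining symmetric block.
\<close>

theorem real_spectral_theorem:
  fixes A :: "real mat"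
  assumes "A \<in> carrier_mat n n" and "A\<^sup>T = A"
  shows "\<exists>P D. P \<in> carrier_mat n n \<and> D \<in> carrier_mat n n \<and> diagonal_mat D \<and>
    P\<^sup>T * P = 1\<^sub>m n \<and> A = P * D * P\<^sup>T"
  using assms
proof (induction n arbitrary: A)
  case 0
  then show ?case by (intro exI[of _ "1\<^sub>m 0"]) (auto simp: diagonal_mat_def)
next
  case (Suc n)
  note A = Suc.prems(1) and sym = Suc.prems(2)
  obtain v e where v: "v \<in> carrier_vec (Suc n)" "v \<noteq> 0\<^sub>v (Suc n)" and ev: "A *\<^sub>v v = e \<cdot>\<^sub>v v"
    using symmetric_mat_real_eigenvector[OF A sym] by auto
  obtain W c where W: "W \<in> carrier_mat (Suc n) (Suc n)" and WW: "W\<^sup>T * W = 1\<^sub>m (Suc n)"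
    and colW: "col W 0 = c \<cdot>\<^sub>v v"
    using orthogonal_mat_with_first_column[OF v] by blast
  have Wt: "W\<^sup>T \<in> carrier_mat (Suc n) (Suc n)" using W by simp
  have WWt: "W * W\<^sup>T = 1\<^sub>m (Suc n)" using mat_mult_left_right_inverse[OF Wt W WW] .
  define B where "B = W\<^sup>T * A * W"
  have B: "B \<in> carrier_mat (Suc n) (Suc n)" using W A by (simp add: B_def)
  have Bt: "B\<^sup>T = B"
    using W Wt A sym by (simp add: B_def transpose_mult[of _ "Suc n" "Suc n" _ "Suc n"] assoc_mult_mat[of _ "Suc n" "Suc n" _ "Suc n" _ "Suc n"])
  have W0: "col W 0 \<in> carrier_vec (Suc n)" using col_dim[of W 0] W by (metis carrier_matD(1))
  have "col B 0 = (W\<^sup>T * A) *\<^sub>v col W 0" unfolding B_def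
    by (rule col_mult2[of _ "Suc n" "Suc n" _ "Suc n"]) (use W A in auto)
  also have "\<dots> = W\<^sup>T *\<^sub>v (A *\<^sub>v col W 0)" using W A W0 by (auto intro!: assoc_mult_mat_vec)
  also have "A *\<^sub>v col W 0 = e \<cdot>\<^sub>v col W 0"
    unfolding colW using A v ev by (simp add: mult_mat_vec[of _ "Suc n" "Suc n"] smult_smult_assoc mult.commute)
  also have "W\<^sup>T *\<^sub>v (e \<cdot>\<^sub>v col W 0) = e \<cdot>\<^sub>v col (W\<^sup>T * W) 0"
    using W W0 by (auto simp: mult_mat_vec[of _ "Suc n" "Suc n"] col_mult2[of _ "Suc n" "Suc n"])
  also have "\<dots> = e \<cdot>\<^sub>v unit_vec (Suc n) 0" unfolding WW by simp
  finally have colB: "col B 0 = e \<cdot>\<^sub>v unit_vec (Suc n) 0" .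
  have Bi0: "B $$ (i, 0) = (if i = 0 then e else 0)" if "i < Suc n" for i
    using arg_cong[OF colB, of "\<lambda>x. x $ i"] that B by (auto simp: unit_vec_def)
  have B0i: "B $$ (0, i) = (if i = 0 then e else 0)" if "i < Suc n" for i
    using Bi0[OF that] arg_cong[OF Bt, of "\<lambda>M. M $$ (0, i)"] that B by auto
  define E where "E = mat 1 1 (\<lambda>_. e)"
  define A' where "A' = mat n n (\<lambda>(i, j). B $$ (Suc i, Suc j))"
  have E: "E \<in> carrier_mat 1 1" and A': "A' \<in> carrier_mat n n" by (auto simp: E_def A'_def)
  have Bblock: "B = four_block_mat E (0\<^sub>m 1 n) (0\<^sub>m n 1) A'"
    by (rule eq_matI) (use B Bi0 B0i in \<open>auto simp: E_def A'_def\<close>)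
  have "A'\<^sup>T = A'"
  proof (rule eq_matI)
    fix i j assume "i < dim_row A'" "j < dim_col A'"
    then show "A'\<^sup>T $$ (i, j) = A' $$ (i, j)"
      using arg_cong[OF Bt, of "\<lambda>M. M $$ (Suc i, Suc j)"] B by (auto simp: A'_def)
  qed (auto simp: A'_def)
  then obtain P D where P: "P \<in> carrier_mat n n" and D: "D \<in> carrier_mat n n" "diagonal_mat D"
    and PP: "P\<^sup>T * P = 1\<^sub>m n" and A'eq: "A' = P * D * P\<^sup>T"
    using Suc.IH[OF A'] by blast
  let ?P = "four_block_mat (1\<^sub>m 1) (0\<^sub>m 1 n) (0\<^sub>m n 1) P"
  let ?D = "four_block_mat E (0\<^sub>m 1 n) (0\<^sub>m n 1) D"
  have P': "?P \<in> carrier_mat (Suc n) (Suc n)" and D': "?D \<in> carrier_mat (Suc n) (Suc n)"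
    using four_block_carrier_mat[OF one_carrier_mat P, of 1] four_block_carrier_mat[OF E D(1)] by simp_all
  have P't: "?P\<^sup>T = four_block_mat (1\<^sub>m 1) (0\<^sub>m 1 n) (0\<^sub>m n 1) P\<^sup>T"
    using P by (subst transpose_four_block_mat[of _ 1 1 _ n _ n]) auto
  have P'P': "?P\<^sup>T * ?P = 1\<^sub>m (Suc n)"
    unfolding P't using P PP
    by (subst mult_four_block_mat[of _ 1 1 _ n _ n _ _ 1 _ n]) auto
  have PD: "?P * ?D = four_block_mat E (0\<^sub>m 1 n) (0\<^sub>m n 1) (P * D)"
    using P D E by (subst mult_four_block_mat[of _ 1 1 _ n _ n _ _ 1 _ n]) auto
  have Beq: "B = ?P * ?D * ?P\<^sup>T"
    unfolding PD P't Bblock A'eq using P D E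
    by (subst mult_four_block_mat[of _ 1 1 _ n _ n _ _ 1 _ n]) auto
  have diag: "diagonal_mat ?D" using D E by (auto simp: diagonal_mat_def)
  define Q where "Q = W * ?P"
  have Q: "Q \<in> carrier_mat (Suc n) (Suc n)" using W P' by (simp add: Q_def)
  have Qt: "Q\<^sup>T = ?P\<^sup>T * W\<^sup>T" unfolding Q_def using W P' by (rule transpose_mult)
  note [simp] = assoc_mult_mat[of _ "Suc n" "Suc n" _ "Suc n" _ "Suc n"]
  have P't': "?P\<^sup>T \<in> carrier_mat (Suc n) (Suc n)" using P' by simp
  have "Q\<^sup>T * Q = ?P\<^sup>T * (W\<^sup>T * W) * ?P"
    unfolding Qt unfolding Q_def using W Wt P' P't' by simp
  also have "\<dots> = 1\<^sub>m (Suc n)" unfolding WW right_mult_one_mat[OF P't'] by (rule P'P')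
  finally have QQ: "Q\<^sup>T * Q = 1\<^sub>m (Suc n)" .
  have "A = (W * W\<^sup>T) * A * (W * W\<^sup>T)" unfolding WWt using A by simp
  also have "\<dots> = W * B * W\<^sup>T" unfolding B_def using W Wt A by simp
  also have "\<dots> = Q * ?D * Q\<^sup>T" unfolding Qt unfolding Beq Q_def using W Wt P' P't' D' by simp
  finally show ?case using Q D' diag QQ by blast
qed

lemma spectral_proots:
  fixes A :: "real mat"
  assumes P: "P \<in> carrier_mat n n" and D: "D \<in> carrier_mat n n" "diagonal_mat D"
    and PP: "P\<^sup>T * P = 1\<^sub>m n" and A: "A = P * D * P\<^sup>T"
  shows "proots (char_poly A) = mset (diag_mat D)"
proof -
  have Pt: "P\<^sup>T \<in> carrier_mat n n" using P by simp
  have "similar_mat A D" unfolding similar_mat_def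
    by (rule exI[of _ P], rule exI[of _ "P\<^sup>T"], rule similar_mat_witI[of _ _ n])
      (use P Pt D A PP mat_mult_left_right_inverse[OF Pt P PP] in auto)
  then have "char_poly A = char_poly D" by (rule char_poly_similar)
  also have "\<dots> = (\<Prod>a\<leftarrow>diag_mat D. [:- a, 1:])"
    using D by (intro char_poly_upper_triangular) (auto simp: diagonal_mat_def upper_triangular_def)
  finally have cp: "char_poly A = (\<Prod>a\<leftarrow>diag_mat D. [:- a, 1:])" .
  have "proots (\<Prod>a\<leftarrow>xs. [:- a, 1:]) = mset xs" for xs :: "real list"
  proof (induction xs)
    case (Cons x xs)
    have "(\<Prod>a\<leftarrow>xs. [:- a, 1:]) \<noteq> 0" by (auto simp: prod_list_zero_iff)
    then show ?case using Cons by (simp add: proots_mult del: mult_pCons_left)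
  qed simp
  then show ?thesis using cp by simp
qed

text \<open>
  How a bound on the second entry of a decreasingly sorted list with repetitions is used: all
  values except one lie below it. Indices instead of values take care of multiplicities.
\<close>

lemma second_of_sorted_multiset_less:
  fixes f :: "nat \<Rightarrow> real"
  assumes "rev (sorted_list_of_multiset (image_mset f (mset_set {..<n}))) ! 1 < t" and "n > 0"
  shows "\<exists>k<n. \<forall>i<n. i \<noteq> k \<longrightarrow> f i < t"
proof -
  define M where "M = image_mset f (mset_set {..<n})"
  define L where "L = rev (sorted_list_of_multiset M)"
  have mL: "mset L = M" by (simp add: L_def)
  have "length L = n" using arg_cong[OF mL, of size] by (simp add: M_def)
  then obtain a L' where L: "L = a # L'" using assms(2) by (cases L) auto
  have "sorted (rev L)" by (simp add: L_def)
  then have sorted: "sorted_wrt (\<ge>) L'" by (simp add: L sorted_wrt_append sorted_wrt_rev)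
  have L': "x < t" if "x \<in> set L'" for x
    using assms(1) that sorted unfolding M_def[symmetric] L_def[symmetric] L
    by (cases L') auto
  have "a \<in># M" using mL L by (metis list.set_intros(1) set_mset_mset)
  then obtain k where k: "k < n" "a = f k" by (auto simp: M_def)
  have "mset_set {..<n} = add_mset k (mset_set ({..<n} - {k}))"
    using k(1) by (simp add: mset_set.remove)
  then have "M = add_mset a (image_mset f (mset_set ({..<n} - {k})))" by (simp add: M_def k(2))
  then have "mset L' = image_mset f (mset_set ({..<n} - {k}))" using mL L by simp
  then have "set_mset (mset L') = set_mset (image_mset f (mset_set ({..<n} - {k})))"
    by (rule arg_cong)
  then have "set L' = f ` ({..<n} - {k})" by simp
  then show ?thesis using k(1) L' by auto
qed

text \<open>
  The Courant--Fischer principle for the second eigenvalue. The hypotheses make the Rayleigh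
  quotient at least \<open>t\<close> on the whole plane spanned by \<open>x\<close> and \<open>y\<close>. If only one
  eigenvalue, with index \<open>k\<close>, were \<open>t\<close> or more, some nonzero vector of the plane would be orthogonal
  to the eigenvector with index \<open>k\<close>, and its Rayleigh quotient would be less than \<open>t\<close>.
\<close>

lemma second_root_ge:
  fixes A :: "real mat"
  assumes A: "A \<in> carrier_mat n n" and sym: "A\<^sup>T = A"
    and x: "x \<in> carrier_vec n" "x \<noteq> 0\<^sub>v n" and y: "y \<in> carrier_vec n" "y \<noteq> 0\<^sub>v n"
    and orth: "x \<bullet> y = 0" "x \<bullet> (A *\<^sub>v y) = 0"
    and Rx: "t * (x \<bullet> x) \<le> x \<bullet> (A *\<^sub>v x)" and Ry: "t * (y \<bullet> y) \<le> y \<bullet> (A *\<^sub>v y)"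
  shows "t \<le> rev (sorted_list_of_multiset (proots (char_poly A))) ! 1"
proof (rule ccontr)
  assume less: "\<not> ?thesis"
  obtain P D where P: "P \<in> carrier_mat n n" and D: "D \<in> carrier_mat n n" "diagonal_mat D"
    and PP: "P\<^sup>T * P = 1\<^sub>m n" and Aeq: "A = P * D * P\<^sup>T"
    using real_spectral_theorem[OF A sym] by blast
  have Pt: "P\<^sup>T \<in> carrier_mat n n" using P by simp
  have PPt: "P * P\<^sup>T = 1\<^sub>m n" using mat_mult_left_right_inverse[OF Pt P PP] .
  have n: "n > 0" using x by (cases n) auto
  have pos: "w \<bullet> w > 0" if "w \<in> carrier_vec n" "w \<noteq> 0\<^sub>v n" for w :: "real vec"
    using conjugate_square_greater_0_vec[OF that(1)] that(2) by (simp add: conjugate_vec_def)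
  have "proots (char_poly A) = image_mset (\<lambda>i. D $$ (i, i)) (mset_set {..<n})"
    using spectral_proots[OF P D PP Aeq] D by (simp add: diag_mat_def atLeast0LessThan)
  with less n obtain k where k: "k < n" and Dk: "\<And>i. i < n \<Longrightarrow> i \<noteq> k \<Longrightarrow> D $$ (i, i) < t"
    using second_of_sorted_multiset_less[of "\<lambda>i. D $$ (i, i)" n t] by auto
  \<comment> \<open>The coordinates in the orthonormal eigenbasis given by the columns of \<open>P\<close>.\<close>
  define p where "p w = P\<^sup>T *\<^sub>v w" for w
  have p: "p w \<in> carrier_vec n" if "w \<in> carrier_vec n" for w
    using Pt that by (simp add: p_def)
  have norm_p: "p w \<bullet> p w = w \<bullet> w" if w: "w \<in> carrier_vec n" for w
  proof -
    have "p w \<bullet> p w = w \<bullet> (P *\<^sub>v p w)"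
      using transpose_vec_mult_scalar[OF P p[OF w] w] by (simp add: p_def)
    also have "P *\<^sub>v p w = w"
      using assoc_mult_mat_vec[OF P Pt w] PPt w by (simp add: p_def)
    finally show ?thesis .
  qed
  have form_p: "w \<bullet> (A *\<^sub>v w) = (\<Sum>i<n. D $$ (i, i) * (p w $ i)\<^sup>2)" if w: "w \<in> carrier_vec n" for w
  proof -
    have Dp: "D *\<^sub>v p w \<in> carrier_vec n" using D p[OF w] by simp
    have "A *\<^sub>v w = P *\<^sub>v (D *\<^sub>v p w)"
      unfolding Aeq p_def using P Pt D w by (simp add: assoc_mult_mat_vec[of _ n n _ n])
    then have "w \<bullet> (A *\<^sub>v w) = p w \<bullet> (D *\<^sub>v p w)"
      using transpose_vec_mult_scalar[OF P Dp w] by (simp add: p_def)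
    also have "\<dots> = (\<Sum>i<n. p w $ i * (D *\<^sub>v p w) $ i)"
      using D by (simp add: scalar_prod_def atLeast0LessThan)
    also have "\<dots> = (\<Sum>i<n. D $$ (i, i) * (p w $ i)\<^sup>2)"
    proof (rule sum.cong)
      fix i assume i: "i \<in> {..<n}"
      have "(D *\<^sub>v p w) $ i = (\<Sum>j<n. D $$ (i, j) * p w $ j)"
        using i D p[OF w] by (auto simp: scalar_prod_def atLeast0LessThan)
      also have "\<dots> = (\<Sum>j<n. if j = i then D $$ (i, i) * p w $ i else 0)"
        using i D by (intro sum.cong) (auto simp: diagonal_mat_def)
      finally show "p w $ i * (D *\<^sub>v p w) $ i = D $$ (i, i) * (p w $ i)\<^sup>2"
        using i by (simp add: power2_eq_square)
    qed simp
    finally show ?thesis .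
  qed
  have upper: "w \<bullet> (A *\<^sub>v w) < t * (w \<bullet> w)"
    if w: "w \<in> carrier_vec n" "w \<noteq> 0\<^sub>v n" and wk: "p w $ k = 0" for w
  proof -
    have sq: "w \<bullet> w = (\<Sum>i<n. (p w $ i)\<^sup>2)"
      using norm_p[OF w(1)] p[OF w(1)]
      by (simp add: scalar_prod_def power2_eq_square atLeast0LessThan)
    with pos[OF w] have "\<exists>i<n. p w $ i \<noteq> 0"
      by (metis (mono_tags, lifting) lessThan_iff less_irrefl power_zero_numeral sum.neutral)
    then obtain j where j: "j < n" "p w $ j \<noteq> 0" by blast
    have jk: "j \<noteq> k" using j wk by auto
    have "(\<Sum>i<n. D $$ (i, i) * (p w $ i)\<^sup>2) < (\<Sum>i<n. t * (p w $ i)\<^sup>2)"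
    proof (rule sum_strict_mono_ex1)
      show "\<forall>i\<in>{..<n}. D $$ (i, i) * (p w $ i)\<^sup>2 \<le> t * (p w $ i)\<^sup>2"
      proof
        fix i assume "i \<in> {..<n}"
        then show "D $$ (i, i) * (p w $ i)\<^sup>2 \<le> t * (p w $ i)\<^sup>2"
          using Dk[of i] wk by (cases "i = k") (auto intro: mult_right_mono)
      qed
      show "\<exists>i\<in>{..<n}. D $$ (i, i) * (p w $ i)\<^sup>2 < t * (p w $ i)\<^sup>2"
        using j Dk[OF j(1) jk] by (intro bexI[of _ j]) auto
    qed simp
    then show ?thesis using form_p[OF w(1)] sq by (simp add: sum_distrib_left)
  qed
  have comb: "\<exists>a b. (a \<noteq> 0 \<or> b \<noteq> 0) \<and> a * p x $ k + b * p y $ k = 0"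
  proof (cases "p x $ k = 0")
    case True
    then show ?thesis by (intro exI[of _ 1] exI[of _ 0]) simp
  next
    case False
    then show ?thesis by (intro exI[of _ "p y $ k"] exI[of _ "- p x $ k"]) simp
  qed
  then obtain a b where ab: "a \<noteq> 0 \<or> b \<noteq> 0" "a * p x $ k + b * p y $ k = 0" by blast
  define z where "z = a \<cdot>\<^sub>v x + b \<cdot>\<^sub>v y"
  have z: "z \<in> carrier_vec n" using x y by (simp add: z_def)
  have yx: "y \<bullet> x = 0" using orth(1) comm_scalar_prod[OF x(1) y(1)] by simp
  have Ax: "A *\<^sub>v x \<in> carrier_vec n" and Ay: "A *\<^sub>v y \<in> carrier_vec n" using A x y by auto
  have yAx: "y \<bullet> (A *\<^sub>v x) = 0"
    using transpose_vec_mult_scalar[OF A x(1) y(1)] sym orth(2) comm_scalar_prod[OF x(1) Ay] by simp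
  have zz: "z \<bullet> z = a\<^sup>2 * (x \<bullet> x) + b\<^sup>2 * (y \<bullet> y)"
    unfolding z_def using x y orth(1) yx
    by (simp add: add_scalar_prod_distrib[of _ n] scalar_prod_add_distrib[of _ n] power2_eq_square algebra_simps)
  have "A *\<^sub>v z = a \<cdot>\<^sub>v (A *\<^sub>v x) + b \<cdot>\<^sub>v (A *\<^sub>v y)"
    unfolding z_def using A x y by (simp add: mult_add_distrib_mat_vec[of _ n n] mult_mat_vec[of _ n n])
  then have zAz: "z \<bullet> (A *\<^sub>v z) = a\<^sup>2 * (x \<bullet> (A *\<^sub>v x)) + b\<^sup>2 * (y \<bullet> (A *\<^sub>v y))"
    using x y Ax Ay orth(2) yAx
    by (simp add: z_def add_scalar_prod_distrib[of _ n] scalar_prod_add_distrib[of _ n] power2_eq_square algebra_simps)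
  have "z \<bullet> z > 0"
    using zz ab(1) pos[OF x] pos[OF y] by (auto intro: add_pos_nonneg add_nonneg_pos)
  then have z0: "z \<noteq> 0\<^sub>v n" using z by auto
  have "p z = a \<cdot>\<^sub>v p x + b \<cdot>\<^sub>v p y"
    unfolding z_def p_def using Pt x y by (simp add: mult_add_distrib_mat_vec[of _ n n] mult_mat_vec[of _ n n])
  then have "p z $ k = 0" using ab(2) k p[OF x(1)] p[OF y(1)] by simp
  then have "z \<bullet> (A *\<^sub>v z) < t * (z \<bullet> z)" using upper[OF z z0] by simp
  moreover have "t * (z \<bullet> z) \<le> z \<bullet> (A *\<^sub>v z)"
    unfolding zz zAz using mult_left_mono[OF Rx, of "a\<^sup>2"] mult_left_mono[OF Ry, of "b\<^sup>2"]
    by (simp add: algebra_simps)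
  ultimately show False by simp
qed

section \<open>Test functions on one side of a cut vertex\<close>

text \<open>
  The pairs fall into couples \<open>(u, w)\<close>, \<open>(w, u)\<close>. Applied to the arcs inside a vertex set, this is
  the handshake lemma.
\<close>

lemma even_card_sym_irrefl:
  assumes "finite R" and "sym R" and "\<And>u. (u, u) \<notin> R"
  shows "even (card R)"
  using assms
proof (induction "card R" arbitrary: R rule: less_induct)
  case less
  show ?case
  proof (cases "R = {}")
    case False
    then obtain u w where uw: "(u, w) \<in> R" by auto
    then have wu: "(w, u) \<in> R" and ne: "u \<noteq> w" using less.prems by (auto dest: symD)
    let ?R = "R - {(u, w), (w, u)}"
    have card: "card R = card ?R + 2"
      using uw wu ne less.prems(1) card_mono[of R "{(u, w), (w, u)}"] by (simp add: card_Diff_subset)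
    have "sym ?R" using less.prems(2) by (auto simp: sym_def)
    then have "even (card ?R)" using less card by simp
    then show ?thesis using card by simp
  qed simp
qed

lemma card_eq_sum_of_bool:
  assumes "finite A"
  shows "real (card {u \<in> A. P u}) = (\<Sum>u\<in>A. of_bool (P u))"
  using assms by (simp add: Collect_conj_eq)

text \<open>
  Here and in the following lemmas, \<open>A\<close> is a union of components of the graph minus \<open>v\<close>, which is
  expressed by \<open>nb\<close>: apart from \<open>v\<close>, every neighbour of a vertex of \<open>A\<close> is in \<open>A\<close>. The degrees of
  the vertices of \<open>A\<close> add up to an even number, and so do their degrees within \<open>A\<close>; the
  difference is the number of edges to \<open>v\<close>.
\<close>

lemma even_boundary_of_even_regular:
  fixes E :: "('a \<times> 'a) set"
  assumes fin: "finite A" and v: "v \<notin> A" and "sym E" and irr: "\<And>u. (u, u) \<notin> E"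
    and nb: "\<And>u. u \<in> A \<Longrightarrow> E `` {u} \<subseteq> insert v A"
    and deg: "\<And>u. u \<in> A \<Longrightarrow> card (E `` {u}) = d"
    and "even d"
  shows "even (card {u \<in> A. (u, v) \<in> E})"
proof -
  have "finite (E `` {u})" if "u \<in> A" for u
    using nb[OF that] fin by (meson finite_insert finite_subset)
  then have "card (Sigma A (\<lambda>u. E `` {u})) = d * card A" using deg fin by simp
  moreover have "Sigma A (\<lambda>u. E `` {u}) = (E \<inter> A \<times> A) \<union> (\<lambda>u. (u, v)) ` {u \<in> A. (u, v) \<in> E}"
    using nb by auto
  moreover have "card \<dots> = card (E \<inter> A \<times> A) + card {u \<in> A. (u, v) \<in> E}"
    using fin v by (subst card_Un_disjoint) (auto simp: card_image inj_on_def)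
  ultimately have total: "card (E \<inter> A \<times> A) + card {u \<in> A. (u, v) \<in> E} = d * card A" by simp
  have "even (card (E \<inter> A \<times> A))"
    using fin \<open>sym E\<close> irr by (intro even_card_sym_irrefl) (auto simp: sym_def)
  moreover have "even (card (E \<inter> A \<times> A) + card {u \<in> A. (u, v) \<in> E})"
    unfolding total using \<open>even d\<close> by simp
  ultimately show ?thesis unfolding even_add by blast
qed

text \<open>
  A vertex of \<open>A\<close> together with its neighbours other than \<open>v\<close> accounts for at least \<open>d\<close> vertices of
  \<open>A\<close>. So some vertex of \<open>A\<close> is not adjacent to \<open>v\<close>, and this one has all its \<open>d\<close> neighbours in \<open>A\<close>.
\<close>

lemma side_size:
  fixes E :: "('a \<times> 'a) set"
  assumes fin: "finite A" and "A \<noteq> {}" and "v \<notin> A" and irr: "\<And>u. (u, u) \<notin> E"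
    and nb: "\<And>u. u \<in> A \<Longrightarrow> E `` {u} \<subseteq> insert v A"
    and deg: "\<And>u. u \<in> A \<Longrightarrow> card (E `` {u}) = d"
    and few: "card {u \<in> A. (u, v) \<in> E} < d"
  shows "d < card A"
proof -
  obtain u where u: "u \<in> A" using \<open>A \<noteq> {}\<close> by auto
  have "E `` {u} \<subseteq> insert v A - {u}" using nb[OF u] irr by auto
  then have "d \<le> card (insert v A - {u})" using deg[OF u] fin by (metis card_mono finite_Diff finite_insert)
  then have "d \<le> card A" using u fin \<open>v \<notin> A\<close> by simp
  then have "{u \<in> A. (u, v) \<in> E} \<noteq> A" using few by auto
  then obtain w where w: "w \<in> A" "(w, v) \<notin> E" by auto
  then have "E `` {w} \<subseteq> A - {w}" using nb irr by auto
  then have "d \<le> card (A - {w})" using deg[OF w(1)] fin by (metis card_mono finite_Diff)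
  moreover have "card (A - {w}) < card A" using w(1) fin by (intro psubset_card_mono) auto
  ultimately show ?thesis by simp
qed

text \<open>
  Let \<open>a\<close> vertices of \<open>A\<close> be adjacent to \<open>v\<close> and \<open>m\<close> not. If every one of the former is adjacent to
  every one of the latter, the partition is equitable, with quotient matrix
  \<open>((d - a, a), (m, d - 1 - m))\<close>; its eigenvalue \<open>d - s\<close> satisfies \<open>s * (m + a + 1 - s) = a\<close> and has
  the eigenvector \<open>(m + 1 - s, m)\<close>. This vector is used as test function on \<open>A\<close> in every case.

  The sum of \<open>f u * f w\<close> over the arcs inside \<open>A\<close> is the sum of \<open>(f u)\<^sup>2\<close>, weighted with the degrees
  within \<open>A\<close>, minus half the sum of \<open>(f u - f w)\<^sup>2\<close> over these arcs. Only edges between the two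
  classes contribute to the latter sum, so the complete join is the worst case. In that case
  the quadratic form exceeds the bound by a positive multiple of \<open>s * (m + a + 1 - s) - a\<close>, so the
  equation for \<open>s\<close> can be relaxed to the inequality \<open>size\<close>.
\<close>

lemma side_test_vector:
  fixes E :: "('a \<times> 'a) set" and s :: real
  assumes fin: "finite A" and v: "v \<notin> A" and "sym E"
    and nb: "\<And>u. u \<in> A \<Longrightarrow> E `` {u} \<subseteq> insert v A"
    and deg: "\<And>u. u \<in> A \<Longrightarrow> card (E `` {u}) = d"
    and some: "card {u \<in> A. (u, v) \<in> E} < card A"
    and s: "s \<le> 1"
    and size: "card {u \<in> A. (u, v) \<in> E} \<le> s * (real (card A) + 1 - s)"
  shows "\<exists>f. (\<forall>u\<in>A. f u > 0) \<and>
    (d - s) * (\<Sum>u\<in>A. (f u)\<^sup>2) \<le> (\<Sum>u\<in>A. \<Sum>w\<in>A. if (u, w) \<in> E then f u * f w else 0)"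
proof -
  \<comment> \<open>The function \<open>g\<close> below indicates adjacency to \<open>v\<close>, so \<open>f\<close> is \<open>m\<close> on the neighbours of \<open>v\<close> and \<open>m + 1 - s\<close> elsewhere.\<close>
  define e :: "'a \<Rightarrow> 'a \<Rightarrow> real" where "e u w = of_bool ((u, w) \<in> E)" for u w
  define g where "g u = e u v" for u
  define a where "a = (\<Sum>u\<in>A. g u)"
  define m where "m = (\<Sum>u\<in>A. 1 - g u)"
  define f where "f u = m + (1 - s) * (1 - g u)" for u
  have a: "a = card {u \<in> A. (u, v) \<in> E}"
    unfolding a_def g_def e_def using card_eq_sum_of_bool[OF fin, of "\<lambda>u. (u, v) \<in> E"] by simp
  have m: "m = card A - a" by (simp add: m_def a_def sum_subtractf)
  have "m + a + 1 - s = card A + 1 - s" using m by simp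
  then have size': "a \<le> s * (m + a + 1 - s)" using size a by simp
  have m_pos: "m > 0" using some a m by simp
  have g01: "g u = 0 \<or> g u = 1" for u by (simp add: g_def e_def)
  have e01: "e u w = 0 \<or> e u w = 1" for u w by (simp add: e_def)
  have e_sym: "e u w = e w u" for u w using \<open>sym E\<close> by (auto simp: e_def dest: symD)
  have e_deg: "(\<Sum>w\<in>A. e u w) = d - g u" if u: "u \<in> A" for u
  proof -
    have "real d = (\<Sum>w\<in>insert v A. e u w)"
    proof -
      have "E `` {u} = {w \<in> insert v A. (u, w) \<in> E}" using nb[OF u] by auto
      then show ?thesis
        using card_eq_sum_of_bool[of "insert v A" "\<lambda>w. (u, w) \<in> E"] fin deg[OF u]
        by (simp only: e_def finite_insert)
    qed
    then show ?thesis using fin v by (simp add: g_def)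
  qed
  have fsq: "(f u)\<^sup>2 = m\<^sup>2 * g u + (m + 1 - s)\<^sup>2 * (1 - g u)" for u
    using g01[of u] by (auto simp: f_def algebra_simps)
  have fsq_g: "(f u)\<^sup>2 * g u = m\<^sup>2 * g u" for u
    using g01[of u] by (auto simp: f_def)
  have norm: "(\<Sum>u\<in>A. (f u)\<^sup>2) = m\<^sup>2 * a + (m + 1 - s)\<^sup>2 * m"
    by (simp add: fsq sum.distrib a_def m_def flip: sum_distrib_left)
  have norm_g: "(\<Sum>u\<in>A. (f u)\<^sup>2 * g u) = m\<^sup>2 * a"
    by (simp add: fsq_g a_def flip: sum_distrib_left)
  have sq1: "(\<Sum>u\<in>A. \<Sum>w\<in>A. e u w * (f u)\<^sup>2) = d * (\<Sum>u\<in>A. (f u)\<^sup>2) - m\<^sup>2 * a"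
  proof -
    have "(\<Sum>u\<in>A. \<Sum>w\<in>A. e u w * (f u)\<^sup>2) = (\<Sum>u\<in>A. d * (f u)\<^sup>2 - (f u)\<^sup>2 * g u)"
      by (intro sum.cong) (simp_all add: e_deg algebra_simps flip: sum_distrib_right)
    then show ?thesis using norm_g by (simp add: sum_subtractf sum_distrib_left)
  qed
  have sq2: "(\<Sum>u\<in>A. \<Sum>w\<in>A. e u w * (f w)\<^sup>2) = d * (\<Sum>u\<in>A. (f u)\<^sup>2) - m\<^sup>2 * a"
    unfolding sq1[symmetric] by (subst sum.swap) (simp add: e_sym)
  have cross: "(\<Sum>u\<in>A. \<Sum>w\<in>A. g u * (1 - g w)) = a * m"
    by (simp add: a_def m_def sum_product)
  have cross': "(\<Sum>u\<in>A. \<Sum>w\<in>A. g w * (1 - g u)) = a * m"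
    by (subst sum.swap) (rule cross)
  have cross_sum: "(\<Sum>u\<in>A. \<Sum>w\<in>A. (1 - s)\<^sup>2 * (g u * (1 - g w) + g w * (1 - g u))) =
      (1 - s)\<^sup>2 * (2 * a * m)"
  proof -
    have "(\<Sum>u\<in>A. \<Sum>w\<in>A. (1 - s)\<^sup>2 * (g u * (1 - g w) + g w * (1 - g u))) =
      (1 - s)\<^sup>2 * ((\<Sum>u\<in>A. \<Sum>w\<in>A. g u * (1 - g w)) + (\<Sum>u\<in>A. \<Sum>w\<in>A. g w * (1 - g u)))"
      by (simp only: sum_distrib_left sum.distrib distrib_left)
    then show ?thesis unfolding cross cross' by simp
  qed
  \<comment> \<open>This is \<open>(f u - f w)\<^sup>2 \<le> (1 - s)\<^sup>2\<close> for arcs between the two classes; \<open>f u = f w\<close> for all others.\<close>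
  have point: "e u w * (f u)\<^sup>2 + e u w * (f w)\<^sup>2 - (1 - s)\<^sup>2 * (g u * (1 - g w) + g w * (1 - g u))
      \<le> 2 * (e u w * (f u * f w))" for u w
    using e01[of u w] g01[of u] g01[of w] zero_le_power2[of "1 - s"]
    by (auto simp: f_def power2_eq_square algebra_simps)
  have "2 * (d * (\<Sum>u\<in>A. (f u)\<^sup>2) - m\<^sup>2 * a) - (1 - s)\<^sup>2 * (2 * a * m) =
    (\<Sum>u\<in>A. \<Sum>w\<in>A. e u w * (f u)\<^sup>2 + e u w * (f w)\<^sup>2
      - (1 - s)\<^sup>2 * (g u * (1 - g w) + g w * (1 - g u)))"
    by (simp only: sum_subtractf sum.distrib sq1 sq2 cross_sum) simp
  also have "\<dots> \<le> (\<Sum>u\<in>A. \<Sum>w\<in>A. 2 * (e u w * (f u * f w)))"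
    by (intro sum_mono point)
  also have "\<dots> = 2 * (\<Sum>u\<in>A. \<Sum>w\<in>A. if (u, w) \<in> E then f u * f w else 0)"
    unfolding sum_distrib_left by (intro sum.cong) (auto simp: e_def)
  finally have lower: "d * (\<Sum>u\<in>A. (f u)\<^sup>2) - m\<^sup>2 * a - (1 - s)\<^sup>2 * (a * m) \<le>
    (\<Sum>u\<in>A. \<Sum>w\<in>A. if (u, w) \<in> E then f u * f w else 0)" by simp
  \<comment> \<open>The surplus over \<open>(d - s) * (\<Sum>u\<in>A. (f u)\<^sup>2)\<close>, in factored form.\<close>
  have "s * (m\<^sup>2 * a + (m + 1 - s)\<^sup>2 * m) - m\<^sup>2 * a - (1 - s)\<^sup>2 * (a * m) =
    m * (m + 1 - s) * (s * (m + a + 1 - s) - a)"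
    by (simp add: power2_eq_square algebra_simps)
  also have "\<dots> \<ge> 0"
    using m_pos s size' by (intro mult_nonneg_nonneg) simp_all
  finally have "(d - s) * (\<Sum>u\<in>A. (f u)\<^sup>2) \<le> d * (\<Sum>u\<in>A. (f u)\<^sup>2) - m\<^sup>2 * a - (1 - s)\<^sup>2 * (a * m)"
    unfolding norm by (simp add: algebra_simps)
  moreover have "f u > 0" for u
    using m_pos s g01[of u] by (auto simp: f_def)
  ultimately show ?thesis using lower by (intro exI[of _ f]) auto
qed

text \<open>
  The number in the statement is \<open>d - s\<close> for the smaller root \<open>s\<close> of \<open>s * (d + 2 - s) = d + 1 - k\<close>,
  that is, the value of the preceding lemma in the extremal case of \<open>d + 1\<close> vertices, \<open>d + 1 - k\<close> of
  them adjacent to \<open>v\<close>. A larger side or fewer neighbours of \<open>v\<close> only help.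
\<close>

lemma side_bound:
  fixes E :: "('a \<times> 'a) set" and k d :: nat
  assumes fin: "finite A" and "A \<noteq> {}" and v: "v \<notin> A" and sym: "sym E" and irr: "\<And>u. (u, u) \<notin> E"
    and nb: "\<And>u. u \<in> A \<Longrightarrow> E `` {u} \<subseteq> insert v A"
    and deg: "\<And>u. u \<in> A \<Longrightarrow> card (E `` {u}) = d"
    and k: "k \<ge> 2" and few: "card {u \<in> A. (u, v) \<in> E} + k \<le> d + 1"
  shows "\<exists>f. (\<forall>u\<in>A. f u > 0) \<and>
    (real d - 2 + sqrt ((real d)\<^sup>2 + 4 * real k)) / 2 * (\<Sum>u\<in>A. (f u)\<^sup>2)
      \<le> (\<Sum>u\<in>A. \<Sum>w\<in>A. if (u, w) \<in> E then f u * f w else 0)"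
proof -
  define r where "r = sqrt ((real d)\<^sup>2 + 4 * real k)"
  define s where "s = (real d + 2 - r) / 2"
  have size: "d < card A"
    using fin \<open>A \<noteq> {}\<close> v irr nb deg few k by (intro side_size[of A v E]) auto
  have r2: "r\<^sup>2 = (real d)\<^sup>2 + 4 * real k" by (simp add: r_def)
  have "real d \<le> r" unfolding r_def by (rule real_le_rsqrt) simp
  then have s1: "s \<le> 1" by (simp add: s_def)
  have "r \<le> real d + 2"
    unfolding r_def using few by (intro real_le_lsqrt) (auto simp: power2_eq_square algebra_simps)
  then have s0: "0 \<le> s" by (simp add: s_def)
  have "real (card {u \<in> A. (u, v) \<in> E}) \<le> real d + 1 - real k" using few by linarith
  also have "real d + 1 - real k = s * (d + 2 - s)"
    using r2 by (simp add: s_def power2_eq_square field_simps)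
  also have "\<dots> \<le> s * (real (card A) + 1 - s)" using s0 size by (intro mult_left_mono) auto
  finally have "card {u \<in> A. (u, v) \<in> E} \<le> s * (real (card A) + 1 - s)" .
  moreover have "card {u \<in> A. (u, v) \<in> E} < card A" using size few k by linarith
  ultimately obtain f where "\<forall>u\<in>A. f u > 0"
    "(d - s) * (\<Sum>u\<in>A. (f u)\<^sup>2) \<le> (\<Sum>u\<in>A. \<Sum>w\<in>A. if (u, w) \<in> E then f u * f w else 0)"
    using side_test_vector[OF fin v sym nb deg _ s1] by blast
  moreover have "d - s = (real d - 2 + r) / 2" by (simp add: s_def field_simps)
  ultimately show ?thesis unfolding r_def by (intro exI[of _ f]) simp
qed

section \<open>Connectivity and cut vertices\<close>

lemma (in graph) card_neighbours: "card (arcs_ends G `` {u}) = out_degree G u"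
proof -
  have "arcs_ends G `` {u} = head G ` out_arcs G u" by (auto simp: arcs_ends_conv out_arcs_def)
  moreover have "inj_on (head G) (out_arcs G u)"
    by (rule inj_onI) (auto intro!: no_multi_arcs simp: arc_to_ends_def)
  ultimately show ?thesis by (simp add: card_image out_degree_def)
qed

lemma (in graph) connected_leaving_edge:
  assumes "Digraph_Component.connected G" and "A \<subseteq> verts G" and "A \<noteq> {}" and "x \<in> verts G - A"
  shows "\<exists>u\<in>A. \<exists>w\<in>verts G - A. (u, w) \<in> arcs_ends G"
proof (rule ccontr)
  assume no: "\<not> ?thesis"
  obtain u where u: "u \<in> A" using assms(3) by auto
  have "strongly_connected G" using symmetric_connected_imp_strongly_connected[OF sym_arcs assms(1)] .
  then have "u \<rightarrow>\<^sup>*\<^bsub>G\<^esub> x" using u assms by auto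
  then have "x \<in> A"
    by (induction rule: reachable_induct) (use u no adj_in_verts in blast)+
  then show False using assms(4) by simp
qed

text \<open>
  Take for \<open>A\<close> the vertices reachable from a vertex that does not reach all of \<open>V\<close>.
\<close>

lemma (in graph) disconnected_split:
  assumes "\<not> Digraph_Component.connected (G \<restriction> V)" and "V \<noteq> {}" and "V \<subseteq> verts G"
  shows "\<exists>A B. A \<noteq> {} \<and> B \<noteq> {} \<and> A \<inter> B = {} \<and> A \<union> B = V \<and> (\<forall>u\<in>A. \<forall>w\<in>B. (u, w) \<notin> arcs_ends G)"
proof -
  let ?H = "G \<restriction> V"
  interpret H: wf_digraph ?H by (rule wellformed_induce_subgraph)
  have "\<exists>u\<in>V. \<exists>w\<in>V. \<not> u \<rightarrow>\<^sup>*\<^bsub>?H\<^esub> w"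
    using assms(1,2) H.connectedI H.reachable_mk_symmetricI by auto
  then obtain u w where uw: "u \<in> V" "w \<in> V" "\<not> u \<rightarrow>\<^sup>*\<^bsub>?H\<^esub> w" by auto
  define A where "A = {x \<in> V. u \<rightarrow>\<^sup>*\<^bsub>?H\<^esub> x}"
  have sep: "(x, y) \<notin> arcs_ends G" if "x \<in> A" "y \<in> V - A" for x y
  proof
    assume "(x, y) \<in> arcs_ends G"
    then have "(x, y) \<in> arcs_ends ?H" using that by (auto simp: arcs_ends_conv A_def)
    then show False using that H.reachable_adj_trans by (auto simp: A_def)
  qed
  have "u \<in> A" "w \<in> V - A" using uw by (auto simp: A_def)
  then have "A \<noteq> {}" "V - A \<noteq> {}" by blast+
  moreover have "A \<union> (V - A) = V" by (auto simp: A_def)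
  ultimately show ?thesis using sep by (intro exI[of _ A] exI[of _ "V - A"]) simp
qed

text \<open>
  A set that realizes the connectivity has at most one vertex, so at least two vertices are left
  after its removal and their graph must be disconnected. The empty set does not disconnect a connected graph.
\<close>

lemma (in graph) cut_vertex_of_connectivity_less_2:
  assumes conn: "Digraph_Component.connected G" and kappa: "vertex_connectivity G < 2"
    and card: "card (verts G) \<ge> 3"
  shows "\<exists>v A B. v \<in> verts G \<and> A \<noteq> {} \<and> B \<noteq> {} \<and> A \<inter> B = {} \<and> A \<union> B = verts G - {v} \<and>
    (\<forall>u\<in>A. \<forall>w\<in>B. (u, w) \<notin> arcs_ends G)"
proof -
  let ?P = "\<lambda>k. \<exists>S \<subseteq> verts G. card S = k \<and>
     (\<not> Digraph_Component.connected (G \<restriction> (verts G - S)) \<or> card (verts G - S) < 2)"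
  have "?P (card (verts G))" by (intro exI[of _ "verts G"]) simp
  then have "?P (vertex_connectivity G)" unfolding vertex_connectivity_def by (rule LeastI)
  then obtain S where S: "S \<subseteq> verts G" "card S < 2"
    and cut: "\<not> Digraph_Component.connected (G \<restriction> (verts G - S)) \<or> card (verts G - S) < 2"
    using kappa by auto
  have finS: "finite S" using S(1) finite_verts finite_subset by blast
  have two: "card (verts G - S) \<ge> 2" using S card finS by (simp add: card_Diff_subset)
  then have disc: "\<not> Digraph_Component.connected (G \<restriction> (verts G - S))"
    using cut by simp
  have ne: "verts G - S \<noteq> {}" using two by (metis card.empty not_numeral_le_zero)
  obtain A B where AB: "A \<noteq> {}" "B \<noteq> {}" "A \<inter> B = {}" "A \<union> B = verts G - S"
      "\<forall>u\<in>A. \<forall>w\<in>B. (u, w) \<notin> arcs_ends G"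
    using disconnected_split[OF disc ne] by auto
  have "S \<noteq> {}"
  proof
    assume "S = {}"
    moreover obtain x where "x \<in> B" using AB(2) by auto
    ultimately show False using connected_leaving_edge[OF conn, of A x] AB by blast
  qed
  then have "card S = 1" using S(2) finS by (metis One_nat_def card_gt_0_iff less_2_cases less_numeral_extra(3))
  then obtain v where "S = {v}" by (auto simp: card_1_singleton_iff)
  then show ?thesis using AB S(1) by blast
qed

section \<open>From vertex functions to eigenvalues\<close>

definition vertex_vec :: "'a list \<Rightarrow> ('a \<Rightarrow> real) \<Rightarrow> real vec" where
  "vertex_vec vs f = vec (length vs) (\<lambda>i. f (vs ! i))"

lemma sum_nth_distinct:
  fixes h :: "'a \<Rightarrow> real"
  assumes "distinct vs"
  shows "(\<Sum>i<length vs. h (vs ! i)) = (\<Sum>u\<in>set vs. h u)"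
  using assms by (intro sum.reindex_bij_betw bij_betw_nth) auto

lemma vertex_vec_scalar_prod:
  assumes "distinct vs"
  shows "vertex_vec vs f \<bullet> vertex_vec vs g = (\<Sum>u\<in>set vs. f u * g u)"
  using sum_nth_distinct[OF assms, of "\<lambda>u. f u * g u"]
  by (simp add: vertex_vec_def scalar_prod_def atLeast0LessThan)

lemma vertex_vec_adj_form:
  assumes "distinct vs"
  shows "vertex_vec vs f \<bullet> (adj_matrix G vs *\<^sub>v vertex_vec vs g) =
    (\<Sum>u\<in>set vs. \<Sum>w\<in>set vs. if (u, w) \<in> arcs_ends G then f u * g w else 0)"
proof -
  define h where "h u = (\<Sum>w\<in>set vs. if (u, w) \<in> arcs_ends G then g w else 0)" for u
  have "adj_matrix G vs *\<^sub>v vertex_vec vs g = vertex_vec vs h"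
  proof (rule eq_vecI)
    fix i assume "i < dim_vec (vertex_vec vs h)"
    then have i: "i < length vs" by (simp add: vertex_vec_def)
    then have "(adj_matrix G vs *\<^sub>v vertex_vec vs g) $ i =
        (\<Sum>j<length vs. if (vs ! i, vs ! j) \<in> arcs_ends G then g (vs ! j) else 0)"
      by (auto simp: adj_matrix_def vertex_vec_def scalar_prod_def atLeast0LessThan intro!: sum.cong)
    also have "\<dots> = h (vs ! i)"
      unfolding h_def using sum_nth_distinct[OF assms, of "\<lambda>w. if (vs ! i, w) \<in> arcs_ends G then g w else 0"] .
    finally show "(adj_matrix G vs *\<^sub>v vertex_vec vs g) $ i = vertex_vec vs h $ i"
      using i by (simp add: vertex_vec_def)
  qed (simp add: adj_matrix_def vertex_vec_def)
  then show ?thesis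
    using vertex_vec_scalar_prod[OF assms, of f h]
    by (auto simp: h_def sum_distrib_left intro!: sum.cong)
qed

text \<open>
  Extended by zero, \<open>f\<close> and \<open>g\<close> are orthogonal, and orthogonal with respect to the adjacency form as
  well because no edge joins their supports.
\<close>

lemma (in graph) second_eigenvalue_ge_of_separated_sets:
  fixes f g :: "'a \<Rightarrow> real"
  assumes A: "A \<subseteq> verts G" "A \<noteq> {}" and B: "B \<subseteq> verts G" "B \<noteq> {}" and disj: "A \<inter> B = {}"
    and sep: "\<forall>u\<in>A. \<forall>w\<in>B. (u, w) \<notin> arcs_ends G"
    and f: "\<forall>u\<in>A. f u > 0" "t * (\<Sum>u\<in>A. (f u)\<^sup>2) \<le>
      (\<Sum>u\<in>A. \<Sum>w\<in>A. if (u, w) \<in> arcs_ends G then f u * f w else 0)"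
    and g: "\<forall>u\<in>B. g u > 0" "t * (\<Sum>u\<in>B. (g u)\<^sup>2) \<le>
      (\<Sum>u\<in>B. \<Sum>w\<in>B. if (u, w) \<in> arcs_ends G then g u * g w else 0)"
  shows "t \<le> graph_eigenvalue 2 G"
proof -
  define vs where "vs = vertex_list G"
  have "distinct vs \<and> set vs = verts G"
    unfolding vs_def vertex_list_def
    by (rule someI_ex) (use finite_distinct_list[OF finite_verts] in blast)
  then have vs: "distinct vs" "set vs = verts G" by auto
  let ?M = "adj_matrix G vs" and ?n = "length vs"
  define ext where "ext S h u = (if u \<in> S then h u else 0)" for S and h :: "'a \<Rightarrow> real" and u
  define x where "x = vertex_vec vs (ext A f)"
  define y where "y = vertex_vec vs (ext B g)"
  have M: "?M \<in> carrier_mat ?n ?n" by (simp add: adj_matrix_def)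
  have sym: "?M\<^sup>T = ?M"
    by (rule eq_matI) (auto simp: adj_matrix_def dest: arcs_ends_symmetric[OF sym_arcs])
  have carr: "x \<in> carrier_vec ?n" "y \<in> carrier_vec ?n" by (simp_all add: x_def y_def vertex_vec_def)
  have norm: "vertex_vec vs (ext S h) \<bullet> vertex_vec vs (ext S h) = (\<Sum>u\<in>S. (h u)\<^sup>2)"
    if "S \<subseteq> verts G" for S h
    unfolding vertex_vec_scalar_prod[OF vs(1)] vs(2) using that
    by (intro sum.mono_neutral_cong_right) (auto simp: ext_def power2_eq_square)
  have form: "vertex_vec vs (ext S h) \<bullet> (?M *\<^sub>v vertex_vec vs (ext S h)) =
      (\<Sum>u\<in>S. \<Sum>w\<in>S. if (u, w) \<in> arcs_ends G then h u * h w else 0)"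
    if S: "S \<subseteq> verts G" for S h
    unfolding vertex_vec_adj_form[OF vs(1)] vs(2)
  proof (rule sum.mono_neutral_cong_right)
    show "(\<Sum>w\<in>verts G. if (u, w) \<in> arcs_ends G then ext S h u * ext S h w else 0) =
        (\<Sum>w\<in>S. if (u, w) \<in> arcs_ends G then h u * h w else 0)" if "u \<in> S" for u
      using S that by (intro sum.mono_neutral_cong_right) (auto simp: ext_def)
  qed (use S in \<open>auto simp: ext_def intro!: sum.neutral\<close>)
  have nz: "vertex_vec vs (ext S h) \<noteq> 0\<^sub>v ?n"
    if "S \<subseteq> verts G" "S \<noteq> {}" "\<forall>u\<in>S. h u > 0" for S h
  proof
    assume "vertex_vec vs (ext S h) = 0\<^sub>v ?n"
    then have "(\<Sum>u\<in>S. (h u)\<^sup>2) = 0" using norm[OF that(1), of h] by simp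
    moreover have "(\<Sum>u\<in>S. (h u)\<^sup>2) > 0"
      using that finite_subset[OF that(1) finite_verts] by (intro sum_pos) force+
    ultimately show False by simp
  qed
  have "x \<bullet> y = 0"
    unfolding x_def y_def vertex_vec_scalar_prod[OF vs(1)]
    using disj by (intro sum.neutral) (auto simp: ext_def)
  moreover have "x \<bullet> (?M *\<^sub>v y) = 0"
    unfolding x_def y_def vertex_vec_adj_form[OF vs(1)]
    using sep by (intro sum.neutral ballI) (auto simp: ext_def)
  ultimately have "t \<le> rev (sorted_list_of_multiset (proots (char_poly ?M))) ! 1"
    using f(2) g(2) nz[OF A f(1)] nz[OF B g(1)] carr
    by (intro second_root_ge[OF M sym, of x y]) (simp_all add: x_def y_def norm form A B)
  then show ?thesis by (simp add: graph_eigenvalue_def graph_spectrum_def vs_def)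
qed

section \<open>Cut vertices of regular graphs\<close>

text \<open>
  Both sides of the cut contain a neighbour of \<open>v\<close>, and their numbers of neighbours add up to \<open>d\<close>. So
  each side has at most \<open>d - 1\<close> of them. If \<open>d\<close> is even, both numbers are even, hence at least two,
  and each side has at most \<open>d - 2\<close>. This accounts for the parameter \<open>k\<close> of the bound on one
  side: 2 in general, and 3 for even \<open>d\<close>.
\<close>

lemma (in graph) regular_cut_vertex_second_eigenvalue:
  assumes reg: "\<forall>v \<in> verts G. out_degree G v = d" and conn: "Digraph_Component.connected G"
    and v: "v \<in> verts G" and A: "A \<noteq> {}" and B: "B \<noteq> {}" and disj: "A \<inter> B = {}"
    and AB: "A \<union> B = verts G - {v}" and sep: "\<forall>u\<in>A. \<forall>w\<in>B. (u, w) \<notin> arcs_ends G"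
  shows "(real d - 2 + sqrt ((real d)\<^sup>2 + 4 * real (if even d then 3 else 2))) / 2
    \<le> graph_eigenvalue 2 G"
proof -
  let ?E = "arcs_ends G"
  define k :: nat where "k = (if even d then 3 else 2)"
  define c where "c S = card {u \<in> S. (u, v) \<in> ?E}" for S
  have sym: "sym ?E" using sym_arcs by (simp add: symmetric_def)
  have irr: "(u, u) \<notin> ?E" for u using adj_not_same by blast
  have deg: "card (?E `` {u}) = d" if "u \<in> verts G" for u
    using card_neighbours reg that by simp
  have fin: "finite A" "finite B" using AB finite_verts by (metis finite_Diff finite_Un)+
  have nb: "?E `` {u} \<subseteq> insert v S"
    if S: "S = A \<or> S = B" "u \<in> S" for S u
  proof
    fix w assume "w \<in> ?E `` {u}"
    then have uw: "(u, w) \<in> ?E" by simp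
    then have "w \<in> insert v (A \<union> B)" using AB adj_in_verts by auto
    then show "w \<in> insert v S" using uw S sep symD[OF sym uw] by blast
  qed
  have bound: "even d \<Longrightarrow> even (c S)" "c S \<ge> 1" if S: "S = A \<or> S = B" for S
  proof -
    have sub: "S \<subseteq> verts G" "v \<notin> S" "finite S" "S \<noteq> {}" using S AB fin A B by auto
    show "even (c S)" if "even d"
      unfolding c_def using sub deg nb[OF S] irr that sym
      by (intro even_boundary_of_even_regular[of S v ?E d]) auto
    obtain u w where "u \<in> S" "w \<in> verts G - S" "(u, w) \<in> ?E"
      using connected_leaving_edge[OF conn sub(1,4)] v sub(2) by blast
    moreover from this have "w = v" using nb[OF S] by blast
    ultimately have "{u \<in> S. (u, v) \<in> ?E} \<noteq> {}" by blast
    then show "c S \<ge> 1" unfolding c_def using sub(3) by (simp add: Suc_le_eq card_gt_0_iff)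
  qed
  have "?E `` {v} = {u \<in> A. (u, v) \<in> ?E} \<union> {u \<in> B. (u, v) \<in> ?E}"
    using AB adj_in_verts irr sym by (auto dest: symD)
  then have "c A + c B = d"
    unfolding c_def using deg[OF v] disj fin by (subst card_Un_disjoint[symmetric]) auto
  moreover have "even d \<Longrightarrow> c A \<noteq> 1 \<and> c B \<noteq> 1" using bound(1) by (metis odd_one)
  ultimately have few: "c A + k \<le> d + 1" "c B + k \<le> d + 1"
    using bound(2)[of A] bound(2)[of B] by (auto simp: k_def)
  have side: "\<exists>f. (\<forall>u\<in>S. f u > 0) \<and>
    (real d - 2 + sqrt ((real d)\<^sup>2 + 4 * real k)) / 2 * (\<Sum>u\<in>S. (f u)\<^sup>2)
      \<le> (\<Sum>u\<in>S. \<Sum>w\<in>S. if (u, w) \<in> ?E then f u * f w else 0)" if S: "S = A \<or> S = B" for S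
  proof (rule side_bound)
    show "card {u \<in> S. (u, v) \<in> ?E} + k \<le> d + 1" using few S by (auto simp: c_def)
    show "card (?E `` {u}) = d" if "u \<in> S" for u using S AB that by (intro deg) auto
    show "?E `` {u} \<subseteq> insert v S" if "u \<in> S" for u using nb[OF S that] .
    show "v \<notin> S" using S AB by auto
  qed (use S A B fin sym irr in \<open>auto simp: k_def\<close>)
  obtain f g where "\<forall>u\<in>A. f u > 0"
    "(real d - 2 + sqrt ((real d)\<^sup>2 + 4 * real k)) / 2 * (\<Sum>u\<in>A. (f u)\<^sup>2)
      \<le> (\<Sum>u\<in>A. \<Sum>w\<in>A. if (u, w) \<in> ?E then f u * f w else 0)"
    and "\<forall>u\<in>B. g u > 0"
    "(real d - 2 + sqrt ((real d)\<^sup>2 + 4 * real k)) / 2 * (\<Sum>u\<in>B. (g u)\<^sup>2)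
      \<le> (\<Sum>u\<in>B. \<Sum>w\<in>B. if (u, w) \<in> ?E then g u * g w else 0)"
    using side[of A] side[of B] by blast
  then show ?thesis
    unfolding k_def[symmetric] using AB A B disj sep
    by (intro second_eigenvalue_ge_of_separated_sets[of A B]) auto
qed

theorem corollary1p3:
  fixes G :: "('a, 'b) pre_digraph" and d :: nat
  assumes "regular_graph d G"
    and "Digraph_Component.connected G"
    and "d \<ge> 3"
    and "graph_eigenvalue 2 G <
      (if even d then (real d - 2 + sqrt ((real d)\<^sup>2 + 12)) / 2
       else (real d - 2 + sqrt ((real d)\<^sup>2 + 8)) / 2)"
  shows "vertex_connectivity G \<ge> 2"
proof (rule ccontr)
  assume "\<not> ?thesis"
  then have kappa: "vertex_connectivity G < 2" by simp
  interpret graph G using assms(1) by (simp add: regular_graph_def)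
  have reg: "\<forall>v \<in> verts G. out_degree G v = d" using assms(1) by (simp add: regular_graph_def)
  obtain u where u: "u \<in> verts G" using assms(2) by (auto simp: connected_conv)
  have "arcs_ends G `` {u} \<subseteq> verts G" using adj_in_verts by auto
  then have "d \<le> card (verts G)" using card_neighbours[of u] reg u card_mono[OF finite_verts] by metis
  then obtain v A B where "v \<in> verts G" "A \<noteq> {}" "B \<noteq> {}" "A \<inter> B = {}" "A \<union> B = verts G - {v}"
      "\<forall>u\<in>A. \<forall>w\<in>B. (u, w) \<notin> arcs_ends G"
    using cut_vertex_of_connectivity_less_2[OF assms(2) kappa] assms(3) by auto
  from regular_cut_vertex_second_eigenvalue[OF reg assms(2) this] assms(4)
  show False by (simp split: if_splits)
qed

end
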